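(* (Weak duality) Let $x\in C$ and let $(z,y^*,\mu)\in C_D$. (i) If $(f\circ F,g\circ G)$ is type I pseudo convex at $z$, then $(f\circ F)(x)\nprec\bar f(z,y^*,\mu)$, i.e. $(f\circ F)(x)-(f\circ F)(z)\notin-\mathrm{int}\,K$. (ii) If $(f\circ F,g\circ G)$ is type II pseudo convex at $z$, then $(f\circ F)(x)\not\preceq\bar f(z,y^*,\mu)$, i.e. $(f\circ F)(x)-(f\circ F)(z)\notin-K\setminus\{0\}$.
   Context: Setting. $X,W,Y,Z$ are Asplund spaces; $F:X\to W$, $f:W\to Y$; $K\subset Y$ is a pointed closed convex cone with nonempty interior; $K^+=\{y^*\in Y^*\mid\langle y^*,y\rangle\ge 0\ \forall y\in K\}$. For $i=1,\dots,n$, $\mathcal V_i$ is a (nonempty) sequentially compact topological space, $\mathcal U_i$ a topological space, $G_i:X\times\mathcal V_i\to Z\times\mathcal U_i$, $g_i:Z\times\mathcal U_i\to\mathbb R$. The primal robust problem $(\mathrm{CRP})$ is: minimize $(f\circ F)(x)$ with respect to $K$ over $C=\{x\in X\mid (g_i\circ G_i)(x,v_i)\le 0\ \forall v_i\in\mathcal V_i,\ i=1,\dots,n\}$. Notation. $\partial$ is the limiting (Mordukhovich) subdifferential. $\langle y^*,f\rangle(w):=\langle y^*,f(w)\rangle$. $\mathrm{cl}^*\mathrm{co}$ is the weak$^*$ closed convex hull. $\partial_x$ is the limiting subdifferential in the first variable with the parameter held fixed; writing $G_i(x,v_i)=(\tilde G_i(x,v_i),\gamma_i(x,v_i))\in Z\times\mathcal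 U_i$, $\partial_x g_i(G_i(z,v_i))\subset Z^*$ is the limiting subdifferential of $g_i(\cdot,\gamma_i(z,v_i))$ at $\tilde G_i(z,v_i)$, and $\langle v_i^*,G_i\rangle(x,v_i):=\langle v_i^*,\tilde G_i(x,v_i)\rangle$. Put $\phi_i(x)=\max_{v_i\in\mathcal V_i}(g_i\circ G_i)(x,v_i)$, $\phi=\max_i\phi_i$, $\mathcal V_i(z)=\{v_i\in\mathcal V_i\mid(g_i\circ G_i)(z,v_i)=\phi_i(z)\}$. Standing assumptions at the point $z$. (A1) $F$ is locally Lipschitz at $z$ and $f$ at $F(z)$. (A2) $\tilde G_i(\cdot,v_i)$ is Lipschitz on a neighborhood of $z$ uniformly in $v_i\in\mathcal V_i$, and $g_i$ is Lipschitz in its $Z$-variable (uniformly) around the points of $G_i(z,\mathcal V_i)$. (A3) $v_i\mapsto G_i(z,v_i)$ and $g_i$ on $G_i(z,\mathcal V_i)$ are locally Lipschitz (with respect to metrics inducing the topologies of $\mathcal V_i,\mathcal U_i$). (A4) $\phi_i,\phi$ are well-defined real-valued functions on $X$ (maxima attained), locally Lipschitz at $z$. (A5) The multifunction $(x,v_i)\mapsto\partial_x(g_i\circ G_i)(x,v_i)$ is weak$^*$ sequentially closed at $(z,\bar v_i)$ for each $\bar v_i\in\mathcal V_i(z)$. Dual problem $(\mathrm{CRD})$: maximize $\bar f(z,y^*,\mu):=(f\circ F)(z)$ with respect to $K$ over the set $C_D$ of all $(z,y^*,\mu)\in X\times(K^+\setminus\{0\})\times\mathbb R^n_+$ such that $$0\in\bigcup_{w^*\in\partial\langle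 y^*,f\rangle(F(z))}\partial\langle w^*,F\rangle(z)+\sum_{i=1}^n\mu_i\,\mathrm{cl}^*\mathrm{co}\Big(\bigcup\Big\{\bigcup_{v_i^*\in\partial_x g_i(G_i(z,v_i))}\partial_x\langle v_i^*,G_i\rangle(z,v_i)\Big|v_i\in\mathcal V_i(z)\Big\}\Big)$$ and $\mu_i\,g_i(G_i(z,v_i))\ge 0$ for $v_i\in\mathcal V_i(z)$, $i=1,\dots,n$. For $u,v\in Y$: $u\prec v$ means $u-v\in-\mathrm{int}\,K$, $u\preceq v$ means $u-v\in-K\setminus\{0\}$; $\nprec,\not\preceq$ are the negations. Pseudo convexity. $(f\circ F,g\circ G)$ is type I pseudo convex at $z\in X$ if for any $x\in X$, $y^*\in K^+$, $w^*\in\partial\langle y^*,f\rangle(F(z))$, $x^*\in\partial\langle w^*,F\rangle(z)$, $v_i^*\in\partial_x g_i(G_i(z,v_i))$, and $x_i^*\in\partial_x\langle v_i^*,G_i\rangle(z,v_i)$, $v_i\in\mathcal V_i(z)$, $i=1,\dots,n$, there exists $\nu\in X$ such that $\langle y^*,f\circ F\rangle(x)<\langle y^*,f\circ F\rangle(z)\Rightarrow\langle x^*,\nu\rangle<0$, and $(g_i\circ G_i)(x,v_i)\le(g_i\circ G_i)(z,v_i)\Rightarrow\langle x_i^*,\nu\rangle\le 0$, $i=1,\dots,n$. It is type II pseudo convex at $z$ if the same holds for any $x\in X\setminus\{z\}$ and $y^*\in K^+\setminus\{0\}$ (other data as before), with the first implication replaced by $\langle y^*,f\circ F\rangle(x)\le\langle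 y^*,f\circ F\rangle(z)\Rightarrow\langle x^*,\nu\rangle<0$.
   Formalization: In both types of pseudo convexity, ν may depend on x, y*, w*, x* but must be common to all i, all v_i in V_i(z), all v_i* and all x_i*; if ν may vary with the choice of these, weak duality is false. *)

theory Defs
  imports "HOL-Analysis.Analysis"
begin

section \<open>Asplund spaces and the weak-star topology\<close>

text \<open>The property is stated for Banach spaces; completeness is carried by the sort.
  \<open>differentiable\<close> is Frechet differentiability with a bounded linear derivative.\<close>

definition asplund :: "'a::banach itself \<Rightarrow> bool" where
  "asplund _ \<longleftrightarrow>
     (\<forall>(S :: 'a set) (h :: 'a \<Rightarrow> real).
        open S \<longrightarrow> convex S \<longrightarrow> convex_on S h \<longrightarrow> continuous_on S h \<longrightarrow>
        S \<subseteq> closure {x \<in> S. h differentiable (at x)})"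

text \<open>On \<open>'a \<Rightarrow>\<^sub>L real\<close> the strong operator topology is the topology of pointwise
  convergence, i.e. the weak-star topology of the dual space.\<close>

abbreviation weak_star :: "('a::real_normed_vector \<Rightarrow>\<^sub>L real) topology" where
  "weak_star \<equiv> strong_operator_topology"

abbreviation wstar_closed_hull ::
  "('a::real_normed_vector \<Rightarrow>\<^sub>L real) set \<Rightarrow> ('a \<Rightarrow>\<^sub>L real) set" where
  "wstar_closed_hull A \<equiv> weak_star closure_of (convex hull A)"

section \<open>Limiting normals and the limiting subdifferential\<close>

text \<open>If \<open>x\<close> is isolated in \<open>\<Omega>\<close> then \<open>at x within \<Omega>\<close> is the trivial filter, the upper limit
  is \<open>-\<infinity>\<close>, and every functional is a normal, as it should be.\<close>

definition frechet_normal_cone ::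
  "'a::real_normed_vector set \<Rightarrow> 'a \<Rightarrow> ('a \<Rightarrow>\<^sub>L real) set" where
  "frechet_normal_cone \<Omega> x =
     (if x \<in> \<Omega>
      then {x'. Limsup (at x within \<Omega>)
                  (\<lambda>u. ereal (blinfun_apply x' (u - x) / norm (u - x))) \<le> 0}
      else {})"

text \<open>Sequential Painleve-Kuratowski upper limit of Frechet normal cones, in the form
  used in Asplund spaces (no epsilon-enlargements).\<close>

definition limiting_normal_cone ::
  "'a::real_normed_vector set \<Rightarrow> 'a \<Rightarrow> ('a \<Rightarrow>\<^sub>L real) set" where
  "limiting_normal_cone \<Omega> x =
     {x'. x \<in> \<Omega> \<and>
        (\<exists>u u'. (\<forall>k::nat. u k \<in> \<Omega> \<and> u' k \<in> frechet_normal_cone \<Omega> (u k)) \<and>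
           u \<longlonglongrightarrow> x \<and> limitin weak_star u' x' sequentially)}"

text \<open>\<open>(x' o\<^sub>L fst_blinfun) - snd_blinfun\<close> is the functional \<open>(x', -1)\<close> on the product of the
  space with the real line.\<close>

definition limiting_subdiff ::
  "('a::real_normed_vector \<Rightarrow> real) \<Rightarrow> 'a \<Rightarrow> ('a \<Rightarrow>\<^sub>L real) set" where
  "limiting_subdiff h x =
     {x'. (x' o\<^sub>L fst_blinfun) - snd_blinfun \<in> limiting_normal_cone (epigraph UNIV h) (x, h x)}"

section \<open>Cones and orders\<close>

definition pointed :: "'a::real_vector set \<Rightarrow> bool" where
  "pointed K \<longleftrightarrow> K \<inter> uminus ` K = {0}"

definition dual_cone :: "'a::real_normed_vector set \<Rightarrow> ('a \<Rightarrow>\<^sub>L real) set" where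
  "dual_cone K = {y'. \<forall>y\<in>K. 0 \<le> blinfun_apply y' y}"

definition cone_less :: "'a::real_normed_vector set \<Rightarrow> 'a \<Rightarrow> 'a \<Rightarrow> bool" where
  "cone_less K u v \<longleftrightarrow> u - v \<in> uminus ` interior K"

definition cone_lesseq :: "'a::real_normed_vector set \<Rightarrow> 'a \<Rightarrow> 'a \<Rightarrow> bool" where
  "cone_lesseq K u v \<longleftrightarrow> u - v \<in> uminus ` K - {0}"

section \<open>The robust composite problem\<close>

text \<open>The index set \<open>{1,\<dots>,n}\<close> is a finite type \<open>'n\<close>. The parameter spaces are abstract
  topologies \<open>V i\<close>, \<open>U i\<close>, one for each \<open>i\<close>, with carriers inside common types \<open>'v\<close>, \<open>'u\<close>;
  everything is relativised to the carriers. The two components of \<open>G i (x, v)\<close> are the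
  \<open>Z\<close>-part and the parameter \<open>\<gamma>\<^sub>i(x, v)\<close>.\<close>

definition seq_compact_topology :: "'a topology \<Rightarrow> bool" where
  "seq_compact_topology T \<longleftrightarrow>
     (\<forall>s :: nat \<Rightarrow> 'a. range s \<subseteq> topspace T \<longrightarrow>
        (\<exists>l r. strict_mono r \<and> limitin T (s \<circ> r) l sequentially))"

definition robust_feasible ::
  "('n \<Rightarrow> 'v topology) \<Rightarrow> ('n \<Rightarrow> 'x \<times> 'v \<Rightarrow> 'z \<times> 'u) \<Rightarrow> ('n \<Rightarrow> 'z \<times> 'u \<Rightarrow> real) \<Rightarrow> 'x set" where
  "robust_feasible V G g = {x. \<forall>i. \<forall>v\<in>topspace (V i). g i (G i (x, v)) \<le> 0}"

text \<open>The supremum is a maximum under assumption \<open>attained\<close> below.\<close>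

definition worst_case ::
  "('n \<Rightarrow> 'v topology) \<Rightarrow> ('n \<Rightarrow> 'x \<times> 'v \<Rightarrow> 'z \<times> 'u) \<Rightarrow> ('n \<Rightarrow> 'z \<times> 'u \<Rightarrow> real) \<Rightarrow>
   'n \<Rightarrow> 'x \<Rightarrow> real" where
  "worst_case V G g i x = (SUP v\<in>topspace (V i). g i (G i (x, v)))"

definition worst_case_max ::
  "('n::finite \<Rightarrow> 'v topology) \<Rightarrow> ('n \<Rightarrow> 'x \<times> 'v \<Rightarrow> 'z \<times> 'u) \<Rightarrow> ('n \<Rightarrow> 'z \<times> 'u \<Rightarrow> real) \<Rightarrow>
   'x \<Rightarrow> real" where
  "worst_case_max V G g x = Max (range (\<lambda>i. worst_case V G g i x))"

definition active ::
  "('n \<Rightarrow> 'v topology) \<Rightarrow> ('n \<Rightarrow> 'x \<times> 'v \<Rightarrow> 'z \<times> 'u) \<Rightarrow> ('n \<Rightarrow> 'z \<times> 'u \<Rightarrow> real) \<Rightarrow>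
   'n \<Rightarrow> 'x \<Rightarrow> 'v set" where
  "active V G g i z = {v \<in> topspace (V i). g i (G i (z, v)) = worst_case V G g i z}"

text \<open>\<open>\<partial>\<^sub>x g\<^sub>i(G\<^sub>i(z, v))\<close>: the parameter is frozen at \<open>\<gamma>\<^sub>i(z, v)\<close>.\<close>

definition subdiff_g ::
  "('n \<Rightarrow> 'x \<times> 'v \<Rightarrow> 'z::real_normed_vector \<times> 'u) \<Rightarrow> ('n \<Rightarrow> 'z \<times> 'u \<Rightarrow> real) \<Rightarrow>
   'n \<Rightarrow> 'x \<Rightarrow> 'v \<Rightarrow> ('z \<Rightarrow>\<^sub>L real) set" where
  "subdiff_g G g i z v = limiting_subdiff (\<lambda>y. g i (y, snd (G i (z, v)))) (fst (G i (z, v)))"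

text \<open>\<open>\<partial>\<^sub>x \<langle>v', G\<^sub>i\<rangle>(z, v)\<close>.\<close>

definition subdiff_G ::
  "('n \<Rightarrow> 'x::real_normed_vector \<times> 'v \<Rightarrow> 'z::real_normed_vector \<times> 'u) \<Rightarrow>
   'n \<Rightarrow> ('z \<Rightarrow>\<^sub>L real) \<Rightarrow> 'x \<Rightarrow> 'v \<Rightarrow> ('x \<Rightarrow>\<^sub>L real) set" where
  "subdiff_G G i v' z v = limiting_subdiff (\<lambda>x. blinfun_apply v' (fst (G i (x, v)))) z"

section \<open>Standing assumptions\<close>

definition locally_lipschitz_at ::
  "('a::metric_space \<Rightarrow> 'b::metric_space) \<Rightarrow> 'a \<Rightarrow> bool" where
  "locally_lipschitz_at h x \<longleftrightarrow> (\<exists>e>0. \<exists>L. L-lipschitz_on (ball x e) h)"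

definition locally_lipschitz_map ::
  "'a metric \<Rightarrow> 'b metric \<Rightarrow> ('a \<Rightarrow> 'b) \<Rightarrow> bool" where
  "locally_lipschitz_map m1 m2 h \<longleftrightarrow>
     (\<forall>p\<in>mspace m1. \<exists>e>0. Lipschitz_continuous_map (submetric m1 {q. mdist m1 p q < e}) m2 h)"

definition lipschitz_Ff ::
  "('x::real_normed_vector \<Rightarrow> 'w::real_normed_vector) \<Rightarrow> ('w \<Rightarrow> 'y::real_normed_vector) \<Rightarrow>
   'x \<Rightarrow> bool" where
  "lipschitz_Ff F f z \<longleftrightarrow> locally_lipschitz_at F z \<and> locally_lipschitz_at f (F z)"

text \<open>Radius and constant are common to all parameter values \<open>v\<close>.\<close>

definition lipschitz_x ::
  "('n \<Rightarrow> 'v topology) \<Rightarrow>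
   ('n \<Rightarrow> 'x::real_normed_vector \<times> 'v \<Rightarrow> 'z::real_normed_vector \<times> 'u) \<Rightarrow>
   ('n \<Rightarrow> 'z \<times> 'u \<Rightarrow> real) \<Rightarrow> 'x \<Rightarrow> bool" where
  "lipschitz_x V G g z \<longleftrightarrow>
     (\<forall>i. (\<exists>e>0. \<exists>L. \<forall>v\<in>topspace (V i). L-lipschitz_on (ball z e) (\<lambda>x. fst (G i (x, v)))) \<and>
          (\<exists>e>0. \<exists>L. \<forall>v\<in>topspace (V i).
             L-lipschitz_on (ball (fst (G i (z, v))) e) (\<lambda>y. g i (y, snd (G i (z, v))))))"

text \<open>The metrics are required to induce the given topologies; \<open>g i\<close> enters only through its
  restriction to the image of the parameter space.\<close>

definition lipschitz_parameter ::
  "('n \<Rightarrow> 'v topology) \<Rightarrow> ('n \<Rightarrow> 'u topology) \<Rightarrow>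
   ('n \<Rightarrow> 'x \<times> 'v \<Rightarrow> 'z::real_normed_vector \<times> 'u) \<Rightarrow>
   ('n \<Rightarrow> 'z \<times> 'u \<Rightarrow> real) \<Rightarrow> 'x \<Rightarrow> bool" where
  "lipschitz_parameter V U G g z \<longleftrightarrow>
     (\<forall>i. \<exists>mV mU. mtopology_of mV = V i \<and> mtopology_of mU = U i \<and>
        locally_lipschitz_map mV (prod_metric euclidean_metric mU) (\<lambda>v. G i (z, v)) \<and>
        locally_lipschitz_map
          (submetric (prod_metric euclidean_metric mU) ((\<lambda>v. G i (z, v)) ` topspace (V i)))
          euclidean_metric (g i))"

definition attained ::
  "('n \<Rightarrow> 'v topology) \<Rightarrow> ('n \<Rightarrow> 'x \<times> 'v \<Rightarrow> 'z \<times> 'u) \<Rightarrow> ('n \<Rightarrow> 'z \<times> 'u \<Rightarrow> real) \<Rightarrow> bool" where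
  "attained V G g \<longleftrightarrow>
     (\<forall>i x. \<exists>v\<in>topspace (V i). \<forall>v'\<in>topspace (V i). g i (G i (x, v')) \<le> g i (G i (x, v)))"

definition lipschitz_max ::
  "('n::finite \<Rightarrow> 'v topology) \<Rightarrow> ('n \<Rightarrow> 'x::real_normed_vector \<times> 'v \<Rightarrow> 'z \<times> 'u) \<Rightarrow>
   ('n \<Rightarrow> 'z \<times> 'u \<Rightarrow> real) \<Rightarrow> 'x \<Rightarrow> bool" where
  "lipschitz_max V G g z \<longleftrightarrow>
     (\<forall>i. locally_lipschitz_at (worst_case V G g i) z) \<and>
     locally_lipschitz_at (worst_case_max V G g) z"

definition subdiff_closed ::
  "('n \<Rightarrow> 'v topology) \<Rightarrow> ('n \<Rightarrow> 'x::real_normed_vector \<times> 'v \<Rightarrow> 'z \<times> 'u) \<Rightarrow>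
   ('n \<Rightarrow> 'z \<times> 'u \<Rightarrow> real) \<Rightarrow> 'x \<Rightarrow> bool" where
  "subdiff_closed V G g z \<longleftrightarrow>
     (\<forall>i. \<forall>v\<in>active V G g i z. \<forall>xs vs xs' x'.
        xs \<longlonglongrightarrow> z \<longrightarrow>
        (\<forall>k::nat. vs k \<in> topspace (V i)) \<longrightarrow> limitin (V i) vs v sequentially \<longrightarrow>
        (\<forall>k. xs' k \<in> limiting_subdiff (\<lambda>x. g i (G i (x, vs k))) (xs k)) \<longrightarrow>
        limitin weak_star xs' x' sequentially \<longrightarrow>
        x' \<in> limiting_subdiff (\<lambda>x. g i (G i (x, v))) z)"

section \<open>The dual problem\<close>

text \<open>Sums of sets are Minkowski sums.\<close>

definition dual_feasible ::
  "('x::real_normed_vector \<Rightarrow> 'w::real_normed_vector) \<Rightarrow> ('w \<Rightarrow> 'y::real_normed_vector) \<Rightarrow>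
   'y set \<Rightarrow> ('n::finite \<Rightarrow> 'v topology) \<Rightarrow>
   ('n \<Rightarrow> 'x \<times> 'v \<Rightarrow> 'z::real_normed_vector \<times> 'u) \<Rightarrow> ('n \<Rightarrow> 'z \<times> 'u \<Rightarrow> real) \<Rightarrow>
   ('x \<times> ('y \<Rightarrow>\<^sub>L real) \<times> (real ^ 'n)) set" where
  "dual_feasible F f K V G g =
     {(z, y', \<mu>). y' \<in> dual_cone K - {0} \<and> (\<forall>i. 0 \<le> \<mu> $ i) \<and>
        0 \<in> (\<Union>w'\<in>limiting_subdiff (\<lambda>w. blinfun_apply y' (f w)) (F z).
               limiting_subdiff (\<lambda>x. blinfun_apply w' (F x)) z)
            + (\<Sum>i\<in>UNIV. (\<lambda>\<xi>. \<mu> $ i *\<^sub>R \<xi>) `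
                 wstar_closed_hull
                   (\<Union>v\<in>active V G g i z. \<Union>v'\<in>subdiff_g G g i z v. subdiff_G G i v' z v)) \<and>
        (\<forall>i. \<forall>v\<in>active V G g i z. 0 \<le> \<mu> $ i * g i (G i (z, v)))}"

definition dual_objective ::
  "('x \<Rightarrow> 'w) \<Rightarrow> ('w \<Rightarrow> 'y::real_normed_vector) \<Rightarrow> 'x \<times> ('y \<Rightarrow>\<^sub>L real) \<times> (real ^ 'n) \<Rightarrow> 'y" where
  "dual_objective F f = (\<lambda>(z, y', \<mu>). (f \<circ> F) z)"

section \<open>Pseudo convexity\<close>

text \<open>The direction \<open>\<nu>\<close> may depend on \<open>x\<close>, \<open>y'\<close>, \<open>w'\<close>, \<open>x'\<close>, but one \<open>\<nu>\<close> has to serve all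
  indices \<open>i\<close>, all active \<open>v\<close> and all \<open>v'\<close>, \<open>\<xi>\<close> at once. If \<open>\<nu>\<close> could also depend on a
  selection of these, the inequalities \<open>\<langle>\<xi>, \<nu>\<rangle> \<le> 0\<close> would not pass to convex combinations,
  and weak duality would fail: take \<open>z = 0\<close> in the plane, \<open>F\<close> the identity,
  \<open>f x = - x\<^sub>1 - x\<^sub>2\<close>, and one constraint with two parameter values \<open>j = 1, 2\<close> and constraint
  functions \<open>x\<^sub>j - x\<^sub>j^2\<close>. Both gradients \<open>e\<^sub>1\<close>, \<open>e\<^sub>2\<close> separately admit a suitable \<open>\<nu>\<close>,
  \<open>(0, 1, 2)\<close> is dual feasible, and the feasible point \<open>(2, 2)\<close> has a smaller objective.\<close>

definition pseudo_convex_I ::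
  "('x::real_normed_vector \<Rightarrow> 'w::real_normed_vector) \<Rightarrow> ('w \<Rightarrow> 'y::real_normed_vector) \<Rightarrow>
   'y set \<Rightarrow> ('n \<Rightarrow> 'v topology) \<Rightarrow>
   ('n \<Rightarrow> 'x \<times> 'v \<Rightarrow> 'z::real_normed_vector \<times> 'u) \<Rightarrow> ('n \<Rightarrow> 'z \<times> 'u \<Rightarrow> real) \<Rightarrow>
   'x \<Rightarrow> bool" where
  "pseudo_convex_I F f K V G g z \<longleftrightarrow>
     (\<forall>x. \<forall>y'\<in>dual_cone K.
      \<forall>w'\<in>limiting_subdiff (\<lambda>w. blinfun_apply y' (f w)) (F z).
      \<forall>x'\<in>limiting_subdiff (\<lambda>u. blinfun_apply w' (F u)) z.
      \<exists>\<nu>.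
        (blinfun_apply y' (f (F x)) < blinfun_apply y' (f (F z)) \<longrightarrow> blinfun_apply x' \<nu> < 0) \<and>
        (\<forall>i. \<forall>v\<in>active V G g i z. \<forall>v'\<in>subdiff_g G g i z v. \<forall>\<xi>\<in>subdiff_G G i v' z v.
           g i (G i (x, v)) \<le> g i (G i (z, v)) \<longrightarrow> blinfun_apply \<xi> \<nu> \<le> 0))"

definition pseudo_convex_II ::
  "('x::real_normed_vector \<Rightarrow> 'w::real_normed_vector) \<Rightarrow> ('w \<Rightarrow> 'y::real_normed_vector) \<Rightarrow>
   'y set \<Rightarrow> ('n \<Rightarrow> 'v topology) \<Rightarrow>
   ('n \<Rightarrow> 'x \<times> 'v \<Rightarrow> 'z::real_normed_vector \<times> 'u) \<Rightarrow> ('n \<Rightarrow> 'z \<times> 'u \<Rightarrow> real) \<Rightarrow>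
   'x \<Rightarrow> bool" where
  "pseudo_convex_II F f K V G g z \<longleftrightarrow>
     (\<forall>x\<in>UNIV - {z}. \<forall>y'\<in>dual_cone K - {0}.
      \<forall>w'\<in>limiting_subdiff (\<lambda>w. blinfun_apply y' (f w)) (F z).
      \<forall>x'\<in>limiting_subdiff (\<lambda>u. blinfun_apply w' (F u)) z.
      \<exists>\<nu>.
        (blinfun_apply y' (f (F x)) \<le> blinfun_apply y' (f (F z)) \<longrightarrow> blinfun_apply x' \<nu> < 0) \<and>
        (\<forall>i. \<forall>v\<in>active V G g i z. \<forall>v'\<in>subdiff_g G g i z v. \<forall>\<xi>\<in>subdiff_G G i v' z v.
           g i (G i (x, v)) \<le> g i (G i (z, v)) \<longrightarrow> blinfun_apply \<xi> \<nu> \<le> 0))"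

end

theory Submission
  imports Defs
begin

text \<open>Scalarising by \<open>y'\<close> turns a violation of weak duality into an inequality between values of
  \<open>\<langle>y', f \<circ> F\<rangle>\<close>, so pseudo convexity yields a direction \<open>\<nu>\<close> with \<open>\<langle>x', \<nu>\<rangle> < 0\<close>. For \<open>\<mu>\<^sub>i > 0\<close>
  complementarity and feasibility give \<open>g\<^sub>i(G\<^sub>i(x, v)) \<le> 0 \<le> g\<^sub>i(G\<^sub>i(z, v))\<close> at all active \<open>v\<close>, so all
  constraint subgradients are nonpositive at \<open>\<nu>\<close>. The functionals that are nonpositive at \<open>\<nu>\<close> form
  a weak-star closed half space, so the whole hull is nonpositive at \<open>\<nu>\<close>, and evaluating the dual
  inclusion at \<open>\<nu>\<close> gives \<open>0 < 0\<close>.\<close>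

text \<open>Evaluation at a fixed \<open>\<nu>\<close> is linear and weak-star continuous, so its
  sublevel sets are convex and weak-star closed; a bound on the generators therefore survives both
  the convex hull and the closure.\<close>

lemma wstar_closed_hull_le:
  fixes A :: "('a::real_normed_vector \<Rightarrow>\<^sub>L real) set"
  assumes "\<And>\<xi>. \<xi> \<in> A \<Longrightarrow> blinfun_apply \<xi> \<nu> \<le> c" and "\<xi> \<in> wstar_closed_hull A"
  shows "blinfun_apply \<xi> \<nu> \<le> c"
proof -
  let ?H = "{\<xi> :: 'a \<Rightarrow>\<^sub>L real. blinfun_apply \<xi> \<nu> \<le> c}"
  have "convex ?H"
    unfolding convex_alt by (auto simp: blinfun.bilinear_simps intro: convex_bound_le)
  then have hull: "convex hull A \<subseteq> ?H"
    using assms(1) by (intro hull_minimal) auto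
  have "closedin weak_star {\<xi> \<in> topspace weak_star. blinfun_apply \<xi> \<nu> \<in> {..c}}"
    by (rule closedin_continuous_map_preimage[OF strong_operator_topology_continuous_evaluation])
      simp
  then have "closedin weak_star ?H"
    by (simp add: strong_operator_topology_topspace)
  with hull have "wstar_closed_hull A \<subseteq> ?H"
    by (rule closure_of_minimal)
  with assms(2) show ?thesis
    by blast
qed

text \<open>A nonzero functional is positive at some \<open>d\<close>. From an interior point a
  short step along \<open>- d\<close> stays in \<open>K\<close>, where \<open>y'\<close> is still
  nonnegative, so before the step it was strictly positive.\<close>

lemma dual_cone_interior_pos:
  fixes y' :: "'a::real_normed_vector \<Rightarrow>\<^sub>L real"
  assumes y': "y' \<in> dual_cone K" "y' \<noteq> 0" and u: "u \<in> interior K"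
  shows "0 < blinfun_apply y' u"
proof -
  obtain d where d: "0 < blinfun_apply y' d"
  proof -
    obtain d where "blinfun_apply y' d \<noteq> 0"
      using y'(2) by (metis blinfun_eqI zero_blinfun.rep_eq)
    then show ?thesis
      using that[of d] that[of "- d"] by (cases "0 < blinfun_apply y' d") (auto simp: blinfun.minus_right)
  qed
  then have "d \<noteq> 0"
    by auto
  obtain e where e: "0 < e" "ball u e \<subseteq> K"
    using u by (auto simp: mem_interior)
  \<comment> \<open>The step \<open>t *\<^sub>R d\<close> has norm \<open>e / 2\<close>, so it does
    not leave the open ball.\<close>
  define t where "t = e / (2 * norm d)"
  have t: "0 < t" "t * norm d < e"
    using e(1) \<open>d \<noteq> 0\<close> by (auto simp: t_def)
  then have "u - t *\<^sub>R d \<in> K"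
    using e(2) by (auto simp: dist_norm)
  then have "0 \<le> blinfun_apply y' (u - t *\<^sub>R d)"
    using y'(1) by (auto simp: dual_cone_def)
  also have "\<dots> = blinfun_apply y' u - t * blinfun_apply y' d"
    by (simp add: blinfun.bilinear_simps)
  finally show ?thesis
    using mult_pos_pos[OF t(1) d] by linarith
qed

lemma cone_less_dual_cone:
  assumes "cone_less K u v" "y' \<in> dual_cone K" "y' \<noteq> 0"
  shows "blinfun_apply y' u < blinfun_apply y' v"
proof -
  have "v - u \<in> interior K"
    using assms(1) by (auto simp: cone_less_def) (metis minus_diff_eq minus_minus)
  from dual_cone_interior_pos[OF assms(2,3) this] show ?thesis
    by (simp add: blinfun.diff_right)
qed

text \<open>Strictness is lost here, since \<open>y'\<close> may vanish at nonzero boundary points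
  of \<open>K\<close>; this is why type II pseudo convexity starts from a non-strict
  inequality.\<close>

lemma cone_lesseq_dual_cone:
  assumes "cone_lesseq K u v" "y' \<in> dual_cone K"
  shows "blinfun_apply y' u \<le> blinfun_apply y' v"
proof -
  have "v - u \<in> K"
    using assms(1) by (auto simp: cone_lesseq_def) (metis minus_diff_eq minus_minus)
  then have "0 \<le> blinfun_apply y' (v - u)"
    using assms(2) by (auto simp: dual_cone_def)
  then show ?thesis
    by (simp add: blinfun.diff_right)
qed

text \<open>Membership in a Minkowski sum provides a summand from every set, so
  \<open>\<xi> i\<close> exists even for indices with \<open>\<mu> $ i = 0\<close>.\<close>

lemma dual_feasible_multiplierE:
  assumes "(z, y', \<mu>) \<in> dual_feasible F f K V G g"
  obtains w' x' \<xi> where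
    "w' \<in> limiting_subdiff (\<lambda>w. blinfun_apply y' (f w)) (F z)"
    "x' \<in> limiting_subdiff (\<lambda>x. blinfun_apply w' (F x)) z"
    "\<And>i. \<xi> i \<in> wstar_closed_hull
           (\<Union>v\<in>active V G g i z. \<Union>v'\<in>subdiff_g G g i z v. subdiff_G G i v' z v)"
    "x' + (\<Sum>i\<in>UNIV. \<mu> $ i *\<^sub>R \<xi> i) = 0"
proof -
  let ?H = "\<lambda>i. wstar_closed_hull
    (\<Union>v\<in>active V G g i z. \<Union>v'\<in>subdiff_g G g i z v. subdiff_G G i v' z v)"
  have "0 \<in> (\<Union>w'\<in>limiting_subdiff (\<lambda>w. blinfun_apply y' (f w)) (F z).
               limiting_subdiff (\<lambda>x. blinfun_apply w' (F x)) z)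
            + (\<Sum>i\<in>UNIV. (\<lambda>\<xi>. \<mu> $ i *\<^sub>R \<xi>) ` ?H i)"
    using assms unfolding dual_feasible_def by blast
  then obtain x' s where
      x': "x' \<in> (\<Union>w'\<in>limiting_subdiff (\<lambda>w. blinfun_apply y' (f w)) (F z).
               limiting_subdiff (\<lambda>x. blinfun_apply w' (F x)) z)"
    and s: "s \<in> (\<Sum>i\<in>UNIV. (\<lambda>\<xi>. \<mu> $ i *\<^sub>R \<xi>) ` ?H i)" and eq: "0 = x' + s"
    by (rule set_plus_elim)
  from s obtain r where r: "s = sum r UNIV" "\<And>i. r i \<in> (\<lambda>\<xi>. \<mu> $ i *\<^sub>R \<xi>) ` ?H i"
    by (auto simp: set_sum_alt)
  from r(2) have "\<forall>i. \<exists>\<xi>. \<xi> \<in> ?H i \<and> r i = \<mu> $ i *\<^sub>R \<xi>"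
    by blast
  then obtain \<xi> where \<xi>: "\<forall>i. \<xi> i \<in> ?H i \<and> r i = \<mu> $ i *\<^sub>R \<xi> i"
    by (rule choice[THEN exE])
  then have "x' + (\<Sum>i\<in>UNIV. \<mu> $ i *\<^sub>R \<xi> i) = x' + s"
    unfolding r(1) by (intro arg_cong[where f = "\<lambda>t. x' + t"] sum.cong) auto
  then have "x' + (\<Sum>i\<in>UNIV. \<mu> $ i *\<^sub>R \<xi> i) = 0"
    using eq by (rule trans[OF _ sym])
  with x' \<xi> show ?thesis
    using that by blast
qed

text \<open>This is the common core of both claims: the hypothesis on \<open>\<nu>\<close> is the
  constraint half shared by the two pseudo convexity notions, and \<open>x'\<close> is minus a sum
  of terms nonpositive at \<open>\<nu>\<close>.\<close>

lemma dual_feasible_objective_subgradient_nonneg: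
  assumes feas: "x \<in> robust_feasible V G g"
    and dual: "(z, y', \<mu>) \<in> dual_feasible F f K V G g"
    and \<nu>: "\<And>i v v' \<xi>. \<lbrakk>v \<in> active V G g i z; v' \<in> subdiff_g G g i z v; \<xi> \<in> subdiff_G G i v' z v;
              g i (G i (x, v)) \<le> g i (G i (z, v))\<rbrakk> \<Longrightarrow> blinfun_apply \<xi> \<nu> \<le> 0"
    and \<xi>: "\<And>i. \<xi> i \<in> wstar_closed_hull
           (\<Union>v\<in>active V G g i z. \<Union>v'\<in>subdiff_g G g i z v. subdiff_G G i v' z v)"
    and eq: "x' + (\<Sum>i\<in>UNIV. \<mu> $ i *\<^sub>R \<xi> i) = 0"
  shows "0 \<le> blinfun_apply x' \<nu>"
proof -
  have "\<mu> $ i * blinfun_apply (\<xi> i) \<nu> \<le> 0" for i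
  \<comment> \<open>With a zero multiplier the sign of \<open>g i\<close> at \<open>z\<close> is
    unknown, but the term vanishes; a positive one can be cancelled from the complementarity
    condition.\<close>
  proof (cases "\<mu> $ i = 0")
    case False
    moreover have "0 \<le> \<mu> $ i"
      using dual by (auto simp: dual_feasible_def)
    ultimately have pos: "0 < \<mu> $ i"
      by simp
    have "g i (G i (x, v)) \<le> g i (G i (z, v))" if v: "v \<in> active V G g i z" for v
    proof -
      have "0 \<le> \<mu> $ i * g i (G i (z, v))"
        using dual v by (auto simp: dual_feasible_def)
      with pos have "0 \<le> g i (G i (z, v))"
        by (simp add: zero_le_mult_iff)
      moreover have "g i (G i (x, v)) \<le> 0"
        using feas v by (auto simp: robust_feasible_def active_def)
      ultimately show ?thesis
        by linarith
    qed
    \<comment> \<open>One \<open>\<nu>\<close> serves all active parameters and subgradients, so the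
      bound holds on the whole union before the hull is taken.\<close>
    then have "blinfun_apply (\<xi> i) \<nu> \<le> 0"
      using \<nu> by (intro wstar_closed_hull_le[OF _ \<xi>]) blast
    with pos show ?thesis
      by (simp add: mult_le_0_iff)
  qed simp
  then have "(\<Sum>i\<in>UNIV. \<mu> $ i * blinfun_apply (\<xi> i) \<nu>) \<le> 0"
    by (intro sum_nonpos)
  moreover have "blinfun_apply x' \<nu> + (\<Sum>i\<in>UNIV. \<mu> $ i * blinfun_apply (\<xi> i) \<nu>)
      = blinfun_apply (x' + (\<Sum>i\<in>UNIV. \<mu> $ i *\<^sub>R \<xi> i)) \<nu>"
    by (simp add: blinfun.bilinear_simps blinfun.sum_left)
  ultimately show ?thesis
    using eq by simp
qed

theorem theorem4p1:
  fixes F :: "'x::banach \<Rightarrow> 'w::banach"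
    and f :: "'w \<Rightarrow> 'y::banach"
    and K :: "'y set"
    and V :: "'n::finite \<Rightarrow> 'v topology"
    and U :: "'n \<Rightarrow> 'u topology"
    and G :: "'n \<Rightarrow> 'x \<times> 'v \<Rightarrow> 'z::banach \<times> 'u"
    and g :: "'n \<Rightarrow> 'z \<times> 'u \<Rightarrow> real"
    and x z :: 'x
    and y' :: "'y \<Rightarrow>\<^sub>L real"
    and \<mu> :: "real ^ 'n"
  assumes "asplund TYPE('x)" and "asplund TYPE('w)" and "asplund TYPE('y)" and "asplund TYPE('z)"
    and "pointed K" and "closed K" and "convex K" and "cone K" and "interior K \<noteq> {}"
    and "\<And>i. topspace (V i) \<noteq> {}" and "\<And>i. seq_compact_topology (V i)"
    and "\<And>i x v. v \<in> topspace (V i) \<Longrightarrow> G i (x, v) \<in> UNIV \<times> topspace (U i)"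
    and "lipschitz_Ff F f z"
    and "lipschitz_x V G g z"
    and "lipschitz_parameter V U G g z"
    and "attained V G g"
    and "lipschitz_max V G g z"
    and "subdiff_closed V G g z"
    and "x \<in> robust_feasible V G g"
    and "(z, y', \<mu>) \<in> dual_feasible F f K V G g"
  shows "(pseudo_convex_I F f K V G g z \<longrightarrow>
            \<not> cone_less K ((f \<circ> F) x) (dual_objective F f (z, y', \<mu>))) \<and>
         (pseudo_convex_II F f K V G g z \<longrightarrow>
            \<not> cone_lesseq K ((f \<circ> F) x) (dual_objective F f (z, y', \<mu>)))"
proof (intro conjI impI notI)
  note feas = \<open>x \<in> robust_feasible V G g\<close>
  note dual = \<open>(z, y', \<mu>) \<in> dual_feasible F f K V G g\<close>
  have y': "y' \<in> dual_cone K" "y' \<noteq> 0"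
    using dual by (auto simp: dual_feasible_def)
  obtain w' x' \<xi> where
      w': "w' \<in> limiting_subdiff (\<lambda>w. blinfun_apply y' (f w)) (F z)"
    and x': "x' \<in> limiting_subdiff (\<lambda>x. blinfun_apply w' (F x)) z"
    and \<xi>: "\<And>i. \<xi> i \<in> wstar_closed_hull
           (\<Union>v\<in>active V G g i z. \<Union>v'\<in>subdiff_g G g i z v. subdiff_G G i v' z v)"
    and eq: "x' + (\<Sum>i\<in>UNIV. \<mu> $ i *\<^sub>R \<xi> i) = 0"
    using dual_feasible_multiplierE[OF dual] by blast
  \<comment> \<open>The condition on \<open>\<nu>\<close> stays open, as each case below obtains its
    own direction.\<close>
  note nonneg = dual_feasible_objective_subgradient_nonneg[OF feas dual _ \<xi> eq]
  {
    assume pc: "pseudo_convex_I F f K V G g z"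
      and less: "cone_less K ((f \<circ> F) x) (dual_objective F f (z, y', \<mu>))"
    have "blinfun_apply y' (f (F x)) < blinfun_apply y' (f (F z))"
      using cone_less_dual_cone[OF less y'] by (simp add: dual_objective_def)
    then obtain \<nu> where "blinfun_apply x' \<nu> < 0"
      and "\<And>i v v' \<xi>. \<lbrakk>v \<in> active V G g i z; v' \<in> subdiff_g G g i z v; \<xi> \<in> subdiff_G G i v' z v;
             g i (G i (x, v)) \<le> g i (G i (z, v))\<rbrakk> \<Longrightarrow> blinfun_apply \<xi> \<nu> \<le> 0"
      using pc y'(1) w' x' unfolding pseudo_convex_I_def by meson
    with nonneg[of \<nu>] show False
      by fastforce
  next
    assume pc: "pseudo_convex_II F f K V G g z"
      and less: "cone_lesseq K ((f \<circ> F) x) (dual_objective F f (z, y', \<mu>))"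
    have le: "blinfun_apply y' (f (F x)) \<le> blinfun_apply y' (f (F z))"
      using cone_lesseq_dual_cone[OF less y'(1)] by (simp add: dual_objective_def)
    \<comment> \<open>If \<open>x = z\<close>, the difference of the objective values would be
      \<open>0\<close>, which \<open>cone_lesseq\<close> excludes.\<close>
    have "x \<in> UNIV - {z}" "y' \<in> dual_cone K - {0}"
      using less y' by (auto simp: cone_lesseq_def dual_objective_def)
    with le obtain \<nu> where "blinfun_apply x' \<nu> < 0"
      and "\<And>i v v' \<xi>. \<lbrakk>v \<in> active V G g i z; v' \<in> subdiff_g G g i z v; \<xi> \<in> subdiff_G G i v' z v;
             g i (G i (x, v)) \<le> g i (G i (z, v))\<rbrakk> \<Longrightarrow> blinfun_apply \<xi> \<nu> \<le> 0"
      using pc w' x' unfolding pseudo_convex_II_def by meson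
    with nonneg[of \<nu>] show False
      by fastforce
  }
qed

end
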